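(* Let $S_n$ be the set of score sequences of length $n$ (with $S_0$ consisting of the empty sequence), and let $S(x)=\sum_{n\ge 0}|S_n|x^n$. For $n\ge1$ let $S^{\mathrm{pt}}_n=S_n\times\{0,1,\dots,n-1\}$ and \[S^{\mathrm{pt}}(x,t)=\sum_{n\ge1}\ \sum_{(s,i)\in S^{\mathrm{pt}}_n} t^{|s^{-1}(i)|}x^n,\] where $|s^{-1}(i)|$ is the number of indices $j$ with $s_j=i$. For $n\ge 1$ let $\mathrm{EGZ}_n$ be the set of multisets of size $n$ with elements in $\mathbb{Z}_n$ whose sum is congruent to $\binom{n}{2}$ modulo $n$, let $|M|_0$ denote the multiplicity of $0$ in $M$, and let \[\mathrm{EGZ}(x,t)=\sum_{n\ge1}\ \sum_{M\in\mathrm{EGZ}_n}t^{|M|_0}x^n.\] Then, as formal power series, \[S^{\mathrm{pt}}(x,t)=\mathrm{EGZ}(x,t)\,S(x).\]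
   Context: A tournament is an orientation of a complete graph. The score sequence of a tournament on $n$ vertices is the sequence $(s_0,\dots,s_{n-1})$ of out-degrees of its vertices arranged in nondecreasing order. Equivalently (Landau), a sequence of integers $(s_0,\dots,s_{n-1})$ is a score sequence iff $0\le s_0\le\cdots\le s_{n-1}\le n-1$, $s_0+\dots+s_{k-1}\ge\binom{k}{2}$ for $1\le k<n$, and $s_0+\dots+s_{n-1}=\binom n2$. *)

theory Defs
  imports
    "HOL-Library.Multiset"
    "HOL-Number_Theory.Cong"
    "HOL-Computational_Algebra.Polynomial"
    "HOL-Computational_Algebra.Formal_Power_Series"
begin

definition tournament :: "'a set \<Rightarrow> ('a \<times> 'a) set \<Rightarrow> bool" where
  "tournament V E \<longleftrightarrow> E \<subseteq> V \<times> V \<and> irrefl E \<and>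
     (\<forall>u\<in>V. \<forall>v\<in>V. u \<noteq> v \<longrightarrow> ((u, v) \<in> E \<longleftrightarrow> (v, u) \<notin> E))"

definition out_deg :: "('a \<times> 'a) set \<Rightarrow> 'a \<Rightarrow> nat" where
  "out_deg E v = card {w. (v, w) \<in> E}"

definition score_sequence :: "'a set \<Rightarrow> ('a \<times> 'a) set \<Rightarrow> nat list" where
  "score_sequence V E = sorted_list_of_multiset (image_mset (out_deg E) (mset_set V))"

text \<open>Every tournament on \<open>n\<close> vertices is isomorphic to one with vertex set \<open>{0..<n}\<close>.\<close>

definition score_sequences :: "nat \<Rightarrow> nat list set" where
  "score_sequences n = {score_sequence {0..<n} E | E. tournament {0..<n} E}"

definition pointed_score_sequences :: "nat \<Rightarrow> (nat list \<times> nat) set" where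
  "pointed_score_sequences n = score_sequences n \<times> {0..<n}"

text \<open>The elements of \<open>\<int>\<^sub>n\<close> are represented by the residues \<open>0, \<dots>, n - 1\<close>.\<close>

definition EGZ :: "nat \<Rightarrow> nat multiset set" where
  "EGZ n = {M. size M = n \<and> set_mset M \<subseteq> {0..<n} \<and> [\<Sum>\<^sub># M = n choose 2] (mod n)}"

text \<open>
  The power series in \<open>x\<close> and \<open>t\<close> below have coefficients of \<open>x ^ n\<close> that are polynomials
  in \<open>t\<close>, so they live in \<open>\<int>[t][[x]]\<close>; \<open>monom 1 k\<close> is \<open>t ^ k\<close>.
\<close>

definition S_gf :: "int poly fps" where
  "S_gf = Abs_fps (\<lambda>n. of_nat (card (score_sequences n)))"

definition S_pt_gf :: "int poly fps" where
  "S_pt_gf = Abs_fps (\<lambda>n. if n \<ge> 1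
     then \<Sum>(s, i)\<in>pointed_score_sequences n. monom 1 (card {j. j < length s \<and> s ! j = i})
     else 0)"

definition EGZ_gf :: "int poly fps" where
  "EGZ_gf = Abs_fps (\<lambda>n. if n \<ge> 1 then \<Sum>M\<in>EGZ n. monom 1 (count M 0) else 0)"

lemma finite_score_sequences: "finite (score_sequences n)"
proof -
  have "score_sequences n \<subseteq> score_sequence {0..<n} ` Pow ({0..<n} \<times> {0..<n})"
    by (auto simp: score_sequences_def tournament_def)
  then show ?thesis
    by (rule finite_subset) auto
qed

lemma score_sequences_0: "score_sequences 0 = {[]}"
  by (auto simp: score_sequences_def score_sequence_def tournament_def irrefl_def)

lemma finite_EGZ: "finite (EGZ n)"
proof -
  have "EGZ n \<subseteq> mset ` {xs. set xs \<subseteq> {0..<n} \<and> length xs = n}"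
  proof
    fix M assume M: "M \<in> EGZ n"
    obtain xs where "mset xs = M"
      using ex_mset by blast
    with M show "M \<in> mset ` {xs. set xs \<subseteq> {0..<n} \<and> length xs = n}"
      by (auto simp: EGZ_def)
  qed
  then show ?thesis
    by (rule finite_subset) (intro finite_imageI finite_lists_length_eq, simp)
qed

end

theory Submission
  imports Defs
begin

text \<open>
  Encode a multiset \<open>M\<close> on \<open>{0..<n}\<close> by its list of multiplicities, read as a walk whose \<open>i\<close>-th
  step is \<open>count M i - 1\<close>. By Landau's theorem the score sequences become the closed walks with
  total area zero and all partial areas nonpositive, while \<open>EGZ n\<close> becomes the closed walks whose area
  is divisible by \<open>n\<close>; the latter condition is invariant under rotation.

  A marked score walk \<open>(s, i)\<close> factors uniquely as \<open>s = X @ Y\<close>, where \<open>X\<close> is the longest prefix of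
  length at most \<open>i\<close> that is itself a score walk; the mark then lies in the first irreducible block of
  \<open>Y\<close>. By a cycle lemma, rotating \<open>Y\<close> to its mark is a bijection onto the walks of \<open>EGZ\<close>, and it takes
  the multiplicity at the mark to the multiplicity of \<open>0\<close>.
\<close>

subsection \<open>Walks and areas\<close>

definition height :: "nat list \<Rightarrow> int" where
  "height xs = int (sum_list xs) - int (length xs)"

text \<open>The sum of the heights of all nonempty prefixes: the first step contributes to each of
  them, hence the factor \<open>1 + int (length xs)\<close>.\<close>

fun area :: "nat list \<Rightarrow> int" where
  "area [] = 0"
| "area (x # xs) = (int x - 1) * (1 + int (length xs)) + area xs"

definition landau_list :: "nat list \<Rightarrow> bool" where
  "landau_list xs \<longleftrightarrow> height xs = 0 \<and> area xs = 0 \<and> (\<forall>j\<le>length xs. area (take j xs) \<le> 0)"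

lemma height_Nil [simp]: "height [] = 0"
  by (simp add: height_def)

lemma height_append: "height (xs @ ys) = height xs + height ys"
  by (simp add: height_def)

lemma area_append: "area (xs @ ys) = area xs + int (length ys) * height xs + area ys"
  by (induction xs) (auto simp: height_def algebra_simps)

lemma area_swap: "area (xs @ ys) - area (ys @ xs) = int (length ys) * height xs - int (length xs) * height ys"
  by (simp add: area_append)

lemma landau_list_prefix: "landau_list (xs @ ys) \<Longrightarrow> area (take j xs) \<le> 0"
  unfolding landau_list_def
  by (cases "j \<le> length xs")
     (auto dest!: spec[of _ "min j (length xs)"] simp: min_def)

lemma landau_list_append:
  assumes "landau_list xs" "landau_list ys"
  shows "landau_list (xs @ ys)"
  unfolding landau_list_def
proof (intro conjI allI impI)
  fix j assume j: "j \<le> length (xs @ ys)"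
  show "area (take j (xs @ ys)) \<le> 0"
  proof (cases "j \<le> length xs")
    case True
    then show ?thesis using assms by (simp add: landau_list_def)
  next
    case False
    then show ?thesis using assms j by (simp add: landau_list_def area_append)
  qed
qed (use assms in \<open>auto simp: landau_list_def height_append area_append\<close>)

lemma landau_list_append_cancel:
  assumes "landau_list xs" "landau_list (xs @ ys)"
  shows "landau_list ys"
  unfolding landau_list_def
proof (intro conjI allI impI)
  fix j assume j: "j \<le> length ys"
  have "area (take (length xs + j) (xs @ ys)) \<le> 0"
    using assms(2) j unfolding landau_list_def by (simp del: take_append)
  then show "area (take j ys) \<le> 0"
    using assms(1) by (simp add: landau_list_def area_append)
qed (use assms in \<open>auto simp: landau_list_def height_append area_append\<close>)

text \<open>By \<open>area_swap\<close> the total length times \<open>height xs\<close> is zero, so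
  both factors are closed. Their areas are then nonpositive with sum zero, hence both zero.\<close>

lemma landau_list_append_swapD:
  assumes "landau_list (xs @ ys)" "landau_list (ys @ xs)"
  shows "landau_list xs"
proof (cases "xs = []")
  case True
  then show ?thesis by (simp add: landau_list_def)
next
  case False
  have hs: "height ys = - height xs" and ar: "area (xs @ ys) = 0" "area (ys @ xs) = 0"
    using assms(1,2) by (auto simp: landau_list_def height_append)
  have "(int (length xs) + int (length ys)) * height xs = 0"
    using area_swap[of xs ys] hs ar by (simp add: algebra_simps)
  moreover have "0 < int (length xs) + int (length ys)"
    using False by (cases xs) auto
  ultimately have h0: "height xs = 0"
    by auto
  have "area xs \<le> 0" "area ys \<le> 0"
    using landau_list_prefix[OF assms(1), of "length xs"]
      landau_list_prefix[OF assms(2), of "length ys"] by auto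
  with ar h0 hs have "area xs = 0"
    by (simp add: area_append)
  then show ?thesis
    using h0 landau_list_prefix[OF assms(1)] by (auto simp: landau_list_def)
qed

lemma area_take_Suc:
  assumes "j < length xs"
  shows "area (take (Suc j) xs) = area (take j xs) + height (take (Suc j) xs)"
  using assms by (simp add: take_Suc_conv_app_nth area_append height_def)

lemma height_take_Suc_ge:
  assumes "j < length xs"
  shows "height (take j xs) - 1 \<le> height (take (Suc j) xs)"
  using assms by (simp add: take_Suc_conv_app_nth height_def)

text \<open>The linear term \<open>int j * h\<close> tilts the area so that it vanishes at both ends
  and becomes periodic. Since the walk has level \<open>- h\<close> at \<open>r\<close>, areas
  measured from \<open>r\<close> are differences between the tilted area and its maximal value at
  \<open>r\<close>.\<close>

lemma landau_list_rotation:
  assumes "height xs = 0" and ar: "area xs = - int (length xs) * h"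
    and r: "r \<le> length xs" "height (take r xs) = - h"
    and max: "\<And>j. j \<le> length xs \<Longrightarrow>
      area (take j xs) + int j * h \<le> area (take r xs) + int r * h"
  shows "landau_list (drop r xs @ take r xs)"
proof -
  have hd: "height (drop r xs) = h"
    using assms(1) r(2) height_append[of "take r xs" "drop r xs"] by simp
  have ad: "area (take j (drop r xs)) = area (take (r + j) xs) - area (take r xs) + int j * h"
    if "r + j \<le> length xs" for j
  proof -
    have "length (take j (drop r xs)) = j"
      using that by simp
    then show ?thesis
      using r area_append[of "take r xs" "take j (drop r xs)"] by (simp add: take_add)
  qed
  have ad_all: "area (drop r xs) = area xs - area (take r xs) + int (length xs - r) * h"
    using ad[of "length xs - r"] r by simp
  \<comment> \<open>For prefixes that wrap around the end,
    \<open>area xs = - int (length xs) * h\<close> makes the same difference formula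
    continue.\<close>
  have at: "area (drop r xs @ take j xs) =
      area (take j xs) + int j * h - (area (take r xs) + int r * h)" if "j \<le> r" for j
    using that r hd ad_all ar by (simp add: area_append algebra_simps of_nat_diff min_def)
  show ?thesis
    unfolding landau_list_def
  proof (intro conjI allI impI)
    show "height (drop r xs @ take r xs) = 0"
      using hd r by (simp add: height_append)
    show "area (drop r xs @ take r xs) = 0"
      using at[of r] by simp
    fix j assume j: "j \<le> length (drop r xs @ take r xs)"
    show "area (take j (drop r xs @ take r xs)) \<le> 0"
    proof (cases "j \<le> length xs - r")
      case True
      then have "r + j \<le> length xs" using r by simp
      with ad[of j] max[of "r + j"] True show ?thesis
        by (simp add: algebra_simps)
    next
      case False
      then have jj: "j - (length xs - r) \<le> r" using j r by auto
      have "take j (drop r xs @ take r xs) = drop r xs @ take (j - (length xs - r)) xs"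
        using False jj by (simp add: min_def)
      then show ?thesis
        using at[OF jj] max[of "j - (length xs - r)"] jj r by simp
    qed
  qed
qed

text \<open>A cycle lemma: start the cyclic word at a maximum of the area, measured from the level that
  makes the total area vanish. Since heights drop by at most one per step, the maximum is
  attained at a point of height exactly zero.\<close>

lemma ex_landau_list_rotation:
  assumes h0: "height xs = 0" and ne: "xs \<noteq> []" and dv: "int (length xs) dvd area xs"
  obtains r where "0 < r" "r \<le> length xs" "landau_list (drop r xs @ take r xs)"
proof -
  let ?n = "length xs"
  obtain h where ar: "area xs = - int ?n * h"
    using dv by (metis dvd_def minus_mult_commute minus_minus)
  define A where "A j = area (take j xs) + int j * h" for j
  define W where "W j = height (take j xs) + h" for j
  have n: "0 < ?n" using ne by simp
  have A0: "A 0 = 0" and An: "A ?n = 0" and W0: "W 0 = h" and Wn: "W ?n = h"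
    using ar h0 by (auto simp: A_def W_def)
  have AS: "A (Suc j) = A j + W (Suc j)" if "j < ?n" for j
    using area_take_Suc[OF that] by (simp add: A_def W_def algebra_simps)
  have WS: "W j - 1 \<le> W (Suc j)" if "j < ?n" for j
    using height_take_Suc_ge[OF that] by (simp add: W_def)
  define m where "m = Max (A ` {..?n})"
  have Am: "A j \<le> m" if "j \<le> ?n" for j
    using that unfolding m_def by auto
  have "m \<in> A ` {..?n}" unfolding m_def by (rule Max_in) auto
  then obtain j0 where j0: "j0 \<le> ?n" "A j0 = m" by auto
  \<comment> \<open>Position 0 is excluded so that the mark \<open>n - r\<close> of the rotated list
    will stay below \<open>n\<close>. Nothing is lost, because \<open>A\<close> agrees at both
    ends.\<close>
  define R where "R = {r. 0 < r \<and> r \<le> ?n \<and> A r = m}"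
  have R: "finite R" "R \<noteq> {}"
  proof -
    show "finite R" by (rule finite_subset[of _ "{..?n}"]) (auto simp: R_def)
    have "(if j0 = 0 then ?n else j0) \<in> R" using j0 n A0 An by (auto simp: R_def)
    then show "R \<noteq> {}" by blast
  qed
  have "\<exists>r. 0 < r \<and> r \<le> ?n \<and> A r = m \<and> W r = 0"
  proof -
    \<comment> \<open>At the last maximum \<open>W\<close> is nonnegative, and one step later, if
      there is one, it is negative; a drop of at most one forces \<open>W r = 0\<close>.\<close>
    define r where "r = Max R"
    have r: "0 < r" "r \<le> ?n" "A r = m"
      using Max_in[OF R] by (auto simp: r_def R_def)
    have last: "A j < m" if "r < j" "j \<le> ?n" for j
    proof -
      have "j \<notin> R"
        using that(1) Max_ge[OF R(1), of j] by (auto simp: r_def)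
      then show ?thesis
        using that Am[of j] by (auto simp: R_def)
    qed
    have Wr: "W r \<ge> 0"
      using AS[of "r - 1"] Am[of "r - 1"] r by simp
    show ?thesis
    proof (cases "r < ?n")
      case True
      then have "W (Suc r) < 0" using AS[of r] last[of "Suc r"] r by simp
      with WS[OF True] Wr have "W r = 0" by simp
      with r show ?thesis by blast
    next
      case False
      then have rn: "r = ?n" using r by simp
      then have m0: "m = 0" using r An by simp
      have h: "h \<ge> 0" using Wr Wn rn by simp
      show ?thesis
      proof (cases "h = 0")
        case True
        then show ?thesis using r rn Wn by auto
      next
        case False
        \<comment> \<open>Here the last maximum is the endpoint, at level \<open>h > 0\<close>. The
          walk also starts at level \<open>h\<close>, so \<open>W 1\<close> is nonnegative, while
          \<open>A 1 \<le> 0\<close> bounds it from above; position 1 is then a maximum of level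
          zero.\<close>
        have "W 1 \<le> 0" using AS[of 0] A0 Am[of 1] m0 n by (simp add: Suc_le_eq)
        moreover have "W 1 \<ge> 0" using WS[of 0] W0 h False n by simp
        ultimately have "W 1 = 0" by simp
        moreover have "A 1 = m" using AS[of 0] A0 m0 n \<open>W 1 = 0\<close> by simp
        ultimately show ?thesis using n by (intro exI[of _ 1]) (simp add: Suc_le_eq)
      qed
    qed
  qed
  then obtain r where r: "0 < r" "r \<le> ?n" "A r = m" "W r = 0" by blast
  have "landau_list (drop r xs @ take r xs)"
    using h0 ar r(2)
  proof (rule landau_list_rotation)
    show "height (take r xs) = - h" using r by (simp add: W_def)
    show "area (take j xs) + int j * h \<le> area (take r xs) + int r * h" if "j \<le> ?n" for j
      using Am[OF that] r by (simp add: A_def)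
  qed
  with r that show thesis by blast
qed

subsection \<open>Rotations\<close>

definition landau_lists :: "nat \<Rightarrow> nat list set" where
  "landau_lists n = {xs. length xs = n \<and> landau_list xs}"

definition EGZ_lists :: "nat \<Rightarrow> nat list set" where
  "EGZ_lists n = {xs. length xs = n \<and> height xs = 0 \<and> int n dvd area xs}"

text \<open>The marked position lies in the first irreducible block (strong component).\<close>

definition first_block_pointed :: "nat \<Rightarrow> (nat list \<times> nat) set" where
  "first_block_pointed n = {(xs, i). xs \<in> landau_lists n \<and> i < n \<and>
     (\<forall>j. 0 < j \<and> j \<le> i \<longrightarrow> \<not> landau_list (take j xs))}"

lemma rotate_eq_rotate: "rotate n xs = rotate n ys \<Longrightarrow> xs = ys"
  using inj_fn[OF inj_rotate1, of n] unfolding rotate_def inj_def by blast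

text \<open>If two marked lists had the same rotation with \<open>i < i'\<close>, then
  \<open>xs\<close> would be \<open>ys\<close> rotated by \<open>i' - i\<close>. As both are Landau
  lists, \<open>landau_list_append_swapD\<close> makes the prefix of \<open>ys\<close> of that
  length a Landau list, ending no later than the mark \<open>i'\<close>.\<close>

lemma inj_on_rotate_first_block_pointed:
  "inj_on (\<lambda>(xs, i). rotate i xs) (first_block_pointed n)"
proof -
  have False if p: "(xs, i) \<in> first_block_pointed n" "(ys, i') \<in> first_block_pointed n"
    and eq: "rotate i xs = rotate i' ys" and less: "i < i'" for xs ys i i'
  proof -
    have len: "length xs = n" "length ys = n" "i < n" "i' < n"
      and L: "landau_list xs" "landau_list ys"
      using p by (auto simp: first_block_pointed_def landau_lists_def)
    define d where "d = i' - i"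
    have "rotate i xs = rotate i (rotate d ys)"
      using eq less by (simp add: d_def rotate_rotate)
    then have "xs = rotate d ys"
      using rotate_eq_rotate by blast
    then have "xs = drop d ys @ take d ys"
      using len less by (simp add: rotate_drop_take d_def)
    then have "landau_list (take d ys)"
      using L landau_list_append_swapD[of "take d ys" "drop d ys"] by simp
    moreover have "0 < d" "d \<le> i'" using less by (auto simp: d_def)
    ultimately show False
      using p(2) by (auto simp: first_block_pointed_def)
  qed note * = this
  show ?thesis
  proof (rule inj_onI, clarify)
    fix xs i ys i'
    assume p: "(xs, i) \<in> first_block_pointed n" "(ys, i') \<in> first_block_pointed n"
      and eq: "rotate i xs = rotate i' ys"
    have "i = i'" using *[OF p eq] *[OF p(2,1) eq[symmetric]] by (meson linorder_neqE_nat)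
    with eq show "xs = ys \<and> i = i'" using rotate_eq_rotate by blast
  qed
qed

text \<open>Rotating a closed walk changes its area by a multiple of its length, so divisibility
  survives. Conversely, the cycle lemma supplies a Landau rotation, and the least mark realising the
  given list lies in the first block. For \<open>n = 0\<close> the empty list has no position to
  mark.\<close>

lemma rotate_first_block_pointed:
  "(\<lambda>(xs, i). rotate i xs) ` first_block_pointed n = (if n = 0 then {} else EGZ_lists n)"
proof (cases "n = 0")
  case True
  then show ?thesis by (auto simp: first_block_pointed_def)
next
  case n: False
  have "rotate i xs \<in> EGZ_lists n" if "(xs, i) \<in> first_block_pointed n" for xs i
  proof -
    have len: "length xs = n" "i < n" and L: "landau_list xs"
      using that by (auto simp: first_block_pointed_def landau_lists_def)
    define us vs where "us = take i xs" and "vs = drop i xs"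
    have xs: "xs = us @ vs" and rot: "rotate i xs = vs @ us" and lens: "length us + length vs = n"
      using len by (auto simp: us_def vs_def rotate_drop_take)
    have "area xs = 0" and h: "height us + height vs = 0"
      using L xs by (auto simp: landau_list_def height_append)
    then have "area (vs @ us) = - (int (length vs) * height us - int (length us) * height vs)"
      using area_swap[of us vs] xs by simp
    also have "\<dots> = int n * height vs"
      using h lens by (simp add: eq_neg_iff_add_eq_0[symmetric] flip: lens) (simp add: algebra_simps)
    finally show ?thesis
      using h lens by (simp add: EGZ_lists_def rot height_append)
  qed
  moreover have "ys \<in> (\<lambda>(xs, i). rotate i xs) ` first_block_pointed n" if "ys \<in> EGZ_lists n" for ys
  proof -
    have ys: "length ys = n" "height ys = 0" "int (length ys) dvd area ys" "ys \<noteq> []"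
      using that n by (auto simp: EGZ_lists_def)
    define Q where "Q i \<longleftrightarrow> i < n \<and> (\<exists>xs\<in>landau_lists n. rotate i xs = ys)" for i
    obtain r where r: "0 < r" "r \<le> length ys" "landau_list (drop r ys @ take r ys)"
      using ex_landau_list_rotation[OF ys(2,4,3)] by blast
    have "rotate (n - r) (drop r ys @ take r ys) = ys"
      using rotate_append[of "drop r ys" "take r ys"] r ys by simp
    then have "Q (n - r)"
      unfolding Q_def using r ys
      by (intro conjI bexI[of _ "drop r ys @ take r ys"]) (auto simp: landau_lists_def)
    then have Q: "Q (Least Q)" by (rule LeastI)
    define i where "i = Least Q"
    obtain xs where i: "i < n" and xs: "xs \<in> landau_lists n" "rotate i xs = ys"
      using Q by (auto simp: Q_def i_def)
    \<comment> \<open>Moving such a prefix to the end would give another Landau list, with the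
      smaller mark \<open>i - j\<close>.\<close>
    have "\<not> landau_list (take j xs)" if j: "0 < j" "j \<le> i" for j
    proof
      assume L: "landau_list (take j xs)"
      have len: "length xs = n" "landau_list xs" using xs by (auto simp: landau_lists_def)
      have "landau_list (drop j xs)"
        using landau_list_append_cancel[OF L, of "drop j xs"] len by simp
      then have "rotate j xs \<in> landau_lists n"
        using L len j i by (simp add: landau_lists_def rotate_drop_take landau_list_append)
      moreover have "rotate (i - j) (rotate j xs) = ys"
        using xs j by (simp add: rotate_rotate)
      ultimately have "Q (i - j)" using i by (auto simp: Q_def)
      then have "i \<le> i - j" unfolding i_def by (rule Least_le)
      with j show False by simp
    qed
    then have "(xs, i) \<in> first_block_pointed n"
      using xs i by (auto simp: first_block_pointed_def)
    with xs show ?thesis by force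
  qed
  ultimately show ?thesis using n by auto
qed

text \<open>Here \<open>k\<close> is the length of the second factor. Cancelling a Landau prefix
  leaves a Landau list, so two factorizations with different cuts would leave between the cuts a
  nonempty Landau prefix of \<open>ys\<close> ending no later than its mark, which is
  excluded.\<close>

lemma bij_betw_append_first_block_pointed:
  "bij_betw (\<lambda>(k, (ys, i), xs). (xs @ ys, length xs + i))
     (SIGMA k:{0..n}. first_block_pointed k \<times> landau_lists (n - k))
     (landau_lists n \<times> {0..<n})"
  (is "bij_betw ?f ?A ?B")
proof -
  have F: "(ys, i) \<in> first_block_pointed k \<longleftrightarrow> length ys = k \<and> landau_list ys \<and> i < k \<and>
     (\<forall>j. 0 < j \<and> j \<le> i \<longrightarrow> \<not> landau_list (take j ys))" for ys i k
    by (auto simp: first_block_pointed_def landau_lists_def)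
  have less: False
    if "landau_list xs" "landau_list xs'" "xs @ ys = xs' @ ys'" "length xs + i = length xs' + i'"
      "length xs < length xs'" "\<forall>j. 0 < j \<and> j \<le> i \<longrightarrow> \<not> landau_list (take j ys)"
    for xs ys xs' ys' i i'
  proof -
    define us where "us = drop (length xs) xs'"
    have xs': "xs' = xs @ us" and us: "ys = us @ ys'"
      using that(3,5) by (auto simp: us_def append_eq_append_conv_if)
        (metis append_take_drop_id)+
    have "landau_list us" using that(1,2) xs' landau_list_append_cancel by blast
    moreover have "0 < length us" "length us \<le> i" using that(4,5) xs' by auto
    ultimately show False using that(6) us by auto
  qed
  have "inj_on ?f ?A"
  proof (rule inj_onI)
    fix p q assume pA: "p \<in> ?A" and qA: "q \<in> ?A" and pq: "?f p = ?f q"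
    obtain k ys i xs where pe: "p = (k, (ys, i), xs)" by (cases p) auto
    obtain k' ys' i' xs' where qe: "q = (k', (ys', i'), xs')" by (cases q) auto
    have p: "k \<in> {0..n}" "k' \<in> {0..n}"
      "(ys, i) \<in> first_block_pointed k" "(ys', i') \<in> first_block_pointed k'"
      "xs \<in> landau_lists (n - k)" "xs' \<in> landau_lists (n - k')"
      and eq: "xs @ ys = xs' @ ys'" "length xs + i = length xs' + i'"
      using pA qA pq unfolding pe qe by auto
    have L: "landau_list xs" "landau_list xs'" using p by (auto simp: landau_lists_def)
    have "length xs = length xs'"
      using less[OF L eq] less[OF L(2,1) eq[symmetric]] p(3,4) unfolding F
      by (meson linorder_neqE_nat)
    with eq p show "p = q"
      by (auto simp: F pe qe)
  qed
  moreover have "?f ` ?A \<subseteq> ?B"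
    by (auto simp: F landau_lists_def landau_list_append)
  moreover have "?B \<subseteq> ?f ` ?A"
  proof clarify
    fix zs i assume zs: "zs \<in> landau_lists n" and i: "i \<in> {0..<n}"
    \<comment> \<open>The admissible cuts. At the last one, a Landau prefix of the remainder
      reaching at most the mark would yield a later cut.\<close>
    define J where "J = {j. j \<le> i \<and> landau_list (take j zs)}"
    have J: "finite J" "0 \<in> J" by (auto simp: J_def landau_list_def)
    define m where "m = Max J"
    have "m \<in> J" unfolding m_def using J by (intro Max_in) auto
    then have m: "m \<le> i" "landau_list (take m zs)" by (auto simp: J_def)
    have len: "length zs = n" "landau_list zs" using zs by (auto simp: landau_lists_def)
    have d: "landau_list (drop m zs)"
      using landau_list_append_cancel[OF m(2), of "drop m zs"] len by simp
    have "\<not> landau_list (take j (drop m zs))" if "0 < j" "j \<le> i - m" for j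
    proof
      assume "landau_list (take j (drop m zs))"
      then have "landau_list (take (m + j) zs)"
        using m landau_list_append by (simp add: take_add)
      then have "m + j \<in> J" using that m by (simp add: J_def)
      then show False using Max_ge[OF J(1), of "m + j"] that by (simp add: m_def)
    qed
    then have "(n - m, (drop m zs, i - m), take m zs) \<in> ?A"
      using m d len i by (auto simp: F landau_lists_def)
    moreover have "(zs, i) = ?f (n - m, (drop m zs, i - m), take m zs)"
      using m len i by simp
    ultimately show "(zs, i) \<in> ?f ` ?A" by (rule rev_image_eqI)
  qed
  ultimately show ?thesis by (auto simp: bij_betw_def)
qed

subsection \<open>Landau's theorem\<close>

text \<open>Truncated subtraction lets only elements below \<open>v\<close> count. This is the
  convex conjugate of the partial sums: the maximum over \<open>k\<close> of \<open>k * v\<close>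
  minus the sum of the \<open>k\<close> smallest elements.\<close>

definition deficit :: "nat multiset \<Rightarrow> nat \<Rightarrow> nat" where
  "deficit M v = (\<Sum>x\<in>#M. v - x)"

text \<open>Landau's conditions in conjugate form: \<open>Suc v choose 2\<close> is the deficit of
  the transitive scores \<open>0, ..., n - 1\<close>. For elements below \<open>n\<close>, equality
  at \<open>n\<close> fixes the sum as \<open>n choose 2\<close>.\<close>

definition landau_mset :: "nat \<Rightarrow> nat multiset \<Rightarrow> bool" where
  "landau_mset n M \<longleftrightarrow> size M = n \<and> (\<forall>v\<le>n. deficit M v \<le> Suc v choose 2) \<and>
     deficit M n = Suc n choose 2"

section \<open>Necessity of Landau's conditions\<close>

lemma double_choose_two: "2 * (n choose 2) = n * (n - 1)"
  by (cases n) (auto simp: choose_two)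

lemma tournament_asym: "tournament V E \<Longrightarrow> (u, v) \<in> E \<Longrightarrow> (v, u) \<notin> E"
  by (cases "u = v") (auto simp: tournament_def irrefl_def)

lemma tournament_vertices: "tournament V E \<Longrightarrow> (u, v) \<in> E \<Longrightarrow> u \<in> V \<and> v \<in> V"
  by (auto simp: tournament_def)

lemma tournament_iff:
  "tournament V E \<Longrightarrow> u \<in> V \<Longrightarrow> v \<in> V \<Longrightarrow> u \<noteq> v \<Longrightarrow> (u, v) \<in> E \<longleftrightarrow> (v, u) \<notin> E"
  unfolding tournament_def by blast

lemma finite_out_neighbours: "tournament V E \<Longrightarrow> finite V \<Longrightarrow> finite {y. (x, y) \<in> E}"
  by (rule finite_subset[of _ V]) (auto dest: tournament_vertices)

text \<open>The edges inside \<open>L\<close> and their converses partition the off-diagonal part of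
  \<open>L \<times> L\<close>.\<close>

lemma tournament_sum_restricted_degrees:
  assumes "tournament V E" "finite L" "L \<subseteq> V"
  shows "2 * (\<Sum>x\<in>L. card {y \<in> L. (x, y) \<in> E}) = card L * (card L - 1)"
proof -
  define e where "e = E \<inter> L \<times> L"
  have fin: "finite e" using assms by (auto simp: e_def)
  have "(\<Sum>x\<in>L. card {y \<in> L. (x, y) \<in> E}) = card (SIGMA x:L. {y \<in> L. (x, y) \<in> E})"
    using assms by (simp add: card_SigmaI)
  also have "(SIGMA x:L. {y \<in> L. (x, y) \<in> E}) = e" by (auto simp: e_def)
  finally have s: "(\<Sum>x\<in>L. card {y \<in> L. (x, y) \<in> E}) = card e" .
  have "card (e \<union> e\<inverse>) = card e + card (e\<inverse>)"
    using fin tournament_asym[OF assms(1)] by (intro card_Un_disjoint) (auto simp: e_def)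
  also have "e \<union> e\<inverse> = L \<times> L - (\<lambda>x. (x, x)) ` L"
  proof -
    have "(x, y) \<in> E \<or> (y, x) \<in> E" if "x \<in> L" "y \<in> L" "x \<noteq> y" for x y
      using assms that unfolding tournament_def by blast
    moreover have "(x, x) \<notin> E" for x
      using assms by (simp add: tournament_def irrefl_def)
    ultimately show ?thesis
      by (auto simp: e_def image_iff)
  qed
  also have "card \<dots> = card L * card L - card L"
    using assms by (subst card_Diff_subset) (auto simp: card_cartesian_product card_image inj_on_def)
  finally show ?thesis using s by (simp add: card_inverse algebra_simps diff_mult_distrib2)
qed

lemma tournament_out_deg_less:
  assumes "tournament V E" "finite V" "x \<in> V"
  shows "out_deg E x < card V"
  unfolding out_deg_def using assms
  by (intro psubset_card_mono) (auto simp: tournament_def irrefl_def)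

text \<open>The \<open>m\<close> vertices of score below \<open>v\<close> span
  \<open>m choose 2\<close> edges, so the deficit is at most \<open>m * v - (m choose 2)\<close>,
  which never exceeds \<open>Suc v choose 2\<close>. At \<open>card V\<close> all vertices count and
  the number of edges gives equality.\<close>

lemma landau_mset_out_deg:
  assumes T: "tournament V E" and fin: "finite V"
  shows "landau_mset (card V) (image_mset (out_deg E) (mset_set V))"
proof -
  let ?M = "image_mset (out_deg E) (mset_set V)"
  have def: "deficit ?M v = (\<Sum>x\<in>V. v - out_deg E x)" for v
    by (simp add: deficit_def sum_unfold_sum_mset image_mset.compositionality comp_def)
  have "deficit ?M v \<le> Suc v choose 2" for v
  proof -
    define L where "L = {x \<in> V. out_deg E x < v}"
    define m where "m = card L"
    have L: "finite L" "L \<subseteq> V" using fin by (auto simp: L_def)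
    have "(\<Sum>x\<in>L. card {y \<in> L. (x, y) \<in> E}) \<le> (\<Sum>x\<in>L. out_deg E x)"
      unfolding out_deg_def
    proof (rule sum_mono)
      fix x
      have "finite {w. (x, w) \<in> E}"
        using finite_out_neighbours[OF T fin] .
      then show "card {y \<in> L. (x, y) \<in> E} \<le> card {w. (x, w) \<in> E}"
        by (rule card_mono) auto
    qed
    then have m1: "m * (m - 1) \<le> 2 * (\<Sum>x\<in>L. out_deg E x)"
      using tournament_sum_restricted_degrees[OF T L] by (simp add: m_def)
    have "deficit ?M v = (\<Sum>x\<in>L. v - out_deg E x)"
      unfolding def by (rule sum.mono_neutral_right) (use fin in \<open>auto simp: L_def\<close>)
    moreover have "(\<Sum>x\<in>L. v - out_deg E x) + (\<Sum>x\<in>L. out_deg E x) = m * v"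
      unfolding sum.distrib[symmetric] by (simp add: L_def m_def)
    ultimately have "2 * deficit ?M v + 2 * (\<Sum>x\<in>L. out_deg E x) = 2 * (m * v)" by simp
    with m1 have "2 * deficit ?M v + m * (m - 1) \<le> 2 * m * v"
      by linarith
    then have "int (2 * deficit ?M v + m * (m - 1)) \<le> int (2 * m * v)"
      by (simp only: of_nat_le_iff)
    then have "2 * int (deficit ?M v) \<le> 2 * int m * int v - int (m * (m - 1))"
      by (simp only: of_nat_add of_nat_mult of_nat_numeral)
    also have "int (m * (m - 1)) = int m * int m - int m" by (cases m) (auto simp: algebra_simps)
    also have "2 * int m * int v - (int m * int m - int m) \<le> int v * (int v + 1)"
    proof -
      \<comment> \<open>The gap is a product of two consecutive integers, hence nonnegative also
        when \<open>m > v\<close>.\<close>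
      have "0 \<le> (int v - int m) * (int v - int m + 1)"
      proof (cases "m \<le> v")
        case False
        then show ?thesis by (intro mult_nonpos_nonpos) simp_all
      qed simp
      then show ?thesis by (simp add: algebra_simps)
    qed
    also have "\<dots> = 2 * int (Suc v choose 2)"
      using arg_cong[OF double_choose_two[of "Suc v"], of int]
      by (simp add: algebra_simps del: binomial_Suc_Suc)
    finally show ?thesis by simp
  qed
  moreover have "deficit ?M (card V) = Suc (card V) choose 2"
  proof -
    have "{y. (x, y) \<in> E} = {y \<in> V. (x, y) \<in> E}" for x using T by (auto simp: tournament_def)
    then have 1: "2 * (\<Sum>x\<in>V. out_deg E x) = card V * (card V - 1)"
      using tournament_sum_restricted_degrees[OF T fin] by (simp add: out_deg_def)
    have "deficit ?M (card V) + (\<Sum>x\<in>V. out_deg E x) = (\<Sum>x\<in>V. card V)"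
      unfolding def sum.distrib[symmetric]
      by (intro sum.cong) (use tournament_out_deg_less[OF T fin] in \<open>auto simp: less_imp_le\<close>)
    then have "2 * deficit ?M (card V) + card V * (card V - 1) = 2 * (card V * card V)"
      using 1 by simp
    then have "2 * deficit ?M (card V) = 2 * (Suc (card V) choose 2)"
      unfolding double_choose_two by (cases "card V") (auto simp: algebra_simps)
    then show ?thesis by simp
  qed
  ultimately show ?thesis by (simp add: landau_mset_def)
qed

section \<open>Sufficiency of Landau's conditions: edge reversals and spreading moves\<close>

lemma tournament_reverse_edge:
  assumes T: "tournament V E" and fin: "finite V" and e: "(u, v) \<in> E"
  defines "E' \<equiv> insert (v, u) (E - {(u, v)})"
  shows "tournament V E'"
    and "out_deg E' = (out_deg E)(u := out_deg E u - 1, v := out_deg E v + 1)"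
proof -
  have uv: "u \<noteq> v" "u \<in> V" "v \<in> V" "(v, u) \<notin> E"
    using e tournament_asym[OF T e] tournament_vertices[OF T e] by auto
  show "tournament V E'"
    unfolding tournament_def
  proof (intro conjI ballI impI)
    show "E' \<subseteq> V \<times> V" "irrefl E'"
      using tournament_vertices[OF T] tournament_asym[OF T] uv by (auto simp: irrefl_def E'_def)
    fix x y assume xy: "x \<in> V" "y \<in> V" "x \<noteq> y"
    then have "(x, y) \<in> E \<longleftrightarrow> (y, x) \<notin> E"
      by (rule tournament_iff[OF T])
    then show "(x, y) \<in> E' \<longleftrightarrow> (y, x) \<notin> E'"
      using uv e by (auto simp: E'_def)
  qed
  have fE: "finite {y. (x, y) \<in> E}" for x
    using finite_out_neighbours[OF T fin] .
  have "{w. (u, w) \<in> E'} = {w. (u, w) \<in> E} - {v}" "{w. (v, w) \<in> E'} = insert u {w. (v, w) \<in> E}"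
    "\<And>x. x \<noteq> u \<Longrightarrow> x \<noteq> v \<Longrightarrow> {w. (x, w) \<in> E'} = {w. (x, w) \<in> E}"
    using uv by (auto simp: E'_def)
  then show "out_deg E' = (out_deg E)(u := out_deg E u - 1, v := out_deg E v + 1)"
    using uv e fE by (auto simp: out_deg_def fun_eq_iff)
qed

text \<open>If \<open>u\<close> beats \<open>v\<close>, reverse that edge. Otherwise the larger
  score of \<open>u\<close> yields some \<open>w\<close> beaten by \<open>u\<close> but not by
  \<open>v\<close>, and reversing the path from \<open>u\<close> through \<open>w\<close> to
  \<open>v\<close> leaves the score of \<open>w\<close> unchanged.\<close>

lemma tournament_transfer:
  assumes T: "tournament V E" and fin: "finite V" and uv: "u \<in> V" "v \<in> V"
    and deg: "out_deg E v < out_deg E u"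
  obtains E' where "tournament V E'"
    "out_deg E' = (out_deg E)(u := out_deg E u - 1, v := out_deg E v + 1)"
proof (cases "(u, v) \<in> E")
  case True
  then show ?thesis using that tournament_reverse_edge[OF T fin] by blast
next
  case False
  have fE: "finite {y. (x, y) \<in> E}" for x
    using finite_out_neighbours[OF T fin] .
  have "\<not> {y. (u, y) \<in> E} \<subseteq> {y. (v, y) \<in> E}"
    using deg card_mono[OF fE[of v]] unfolding out_deg_def by (meson not_le)
  then obtain w where w: "(u, w) \<in> E" "(v, w) \<notin> E" by auto
  have "w \<in> V" and wv: "w \<noteq> u" "w \<noteq> v" "u \<noteq> v"
    using tournament_vertices[OF T w(1)] tournament_asym[OF T w(1)] w(1) False deg by auto
  then have "(w, v) \<in> E"
    using tournament_iff[OF T] w(2) uv(2) by blast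
  define E1 where "E1 = insert (w, u) (E - {(u, w)})"
  have E1: "tournament V E1" "out_deg E1 = (out_deg E)(u := out_deg E u - 1, w := out_deg E w + 1)"
    using tournament_reverse_edge[OF T fin w(1)] by (auto simp: E1_def)
  have "(w, v) \<in> E1" using wv \<open>(w, v) \<in> E\<close> by (auto simp: E1_def)
  from tournament_reverse_edge[OF E1(1) fin this] show ?thesis
    using that wv unfolding E1(2) by (auto simp: fun_upd_twist)
qed

lemma deficit_add_mset [simp]: "deficit (add_mset x M) v = (v - x) + deficit M v"
  by (simp add: deficit_def)

lemma deficit_empty [simp]: "deficit {#} v = 0"
  by (simp add: deficit_def)

lemma deficit_0 [simp]: "deficit M 0 = 0"
  by (simp add: deficit_def)

text \<open>The deficit is piecewise linear and convex in \<open>v\<close>, and each element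
  \<open>x\<close> contributes a unit kink at \<open>v = x\<close>.\<close>

lemma deficit_second_difference:
  "deficit M (Suc (Suc v)) + deficit M v = 2 * deficit M (Suc v) + count M (Suc v)"
  by (induction M) auto

lemma deficit_1: "deficit M (Suc 0) = count M 0"
  by (induction M) auto

text \<open>The second difference of \<open>Suc v choose 2\<close> is 1, so every value below
  \<open>n\<close> occurs exactly once; these values already exhaust the size.\<close>

lemma tight_landau_mset:
  assumes "size M = n" and tight: "\<And>v. v \<le> n \<Longrightarrow> deficit M v = Suc v choose 2"
  shows "M = mset_set {0..<n}"
proof -
  have "count M v = 1" if "v < n" for v
  proof (cases v)
    case 0
    then show ?thesis using that tight[of 1] deficit_1[of M] by (simp add: numeral_2_eq_2)
  next
    case (Suc w)
    then show ?thesis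
      using that deficit_second_difference[of M w] tight[of w] tight[of "Suc w"] tight[of "Suc (Suc w)"]
      by (simp add: numeral_2_eq_2)
  qed
  then have "mset_set {0..<n} \<subseteq># M"
    by (auto simp: subseteq_mset_def count_mset_set')
  moreover have "size (mset_set {0..<n}) = size M"
    using assms by simp
  ultimately show ?thesis
    by (metis mset_subset_size order_less_irrefl subset_mset.le_imp_less_or_eq)
qed

lemma ex_tournament_transitive:
  "\<exists>E. tournament {0..<n} E \<and> image_mset (out_deg E) (mset_set {0..<n}) = mset_set {0..<n}"
proof (intro exI conjI)
  let ?E = "{(x, y). y < x \<and> x < (n::nat)}"
  show "tournament {0..<n} ?E" by (auto simp: tournament_def irrefl_def)
  have "out_deg ?E x = x" if "x < n" for x
  proof -
    have "{w. (x, w) \<in> ?E} = {..<x}" using that by auto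
    then show ?thesis by (simp add: out_deg_def)
  qed
  then have "image_mset (out_deg ?E) (mset_set {0..<n}) = image_mset id (mset_set {0..<n})"
    by (intro image_mset_cong) simp
  then show "image_mset (out_deg ?E) (mset_set {0..<n}) = mset_set {0..<n}"
    by simp
qed

text \<open>Undoes a spreading move: a unit of score passes from a vertex of score
  \<open>b + 2\<close> to one of score \<open>b\<close>.\<close>

lemma realizable_transfer:
  assumes T: "tournament V E" and fin: "finite V"
    and M: "image_mset (out_deg E) (mset_set V) = add_mset (Suc (Suc b)) (add_mset b N)"
  obtains E' where "tournament V E'"
    "image_mset (out_deg E') (mset_set V) = add_mset (Suc b) (add_mset (Suc b) N)"
proof -
  have "Suc (Suc b) \<in># image_mset (out_deg E) (mset_set V)" "b \<in># image_mset (out_deg E) (mset_set V)"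
    unfolding M by auto
  then obtain u v where uv: "u \<in> V" "v \<in> V" "out_deg E u = Suc (Suc b)" "out_deg E v = b"
    using fin by auto
  then have "u \<noteq> v" by auto
  obtain E' where E': "tournament V E'"
    "out_deg E' = (out_deg E)(u := out_deg E u - 1, v := out_deg E v + 1)"
    using tournament_transfer[OF T fin uv(1,2)] uv by auto
  have V: "mset_set V = add_mset u (add_mset v (mset_set (V - {u, v})))"
  proof -
    have "mset_set (insert u (insert v (V - {u, v}))) = add_mset u (add_mset v (mset_set (V - {u, v})))"
      using fin \<open>u \<noteq> v\<close> by simp
    moreover have "insert u (insert v (V - {u, v})) = V"
      using uv by auto
    ultimately show ?thesis
      by metis
  qed
  have "image_mset (out_deg E') (mset_set (V - {u, v})) = image_mset (out_deg E) (mset_set (V - {u, v}))"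
    using fin E'(2) by (intro image_mset_cong) auto
  then have "image_mset (out_deg E') (mset_set V) = add_mset (Suc b) (add_mset (Suc b) N)"
    using M uv \<open>u \<noteq> v\<close> unfolding V E'(2) by simp
  with E' that show thesis by blast
qed

text \<open>At the first minimum of \<open>deficit M v - (Suc v choose 2)\<close> the multiplicity is at least two;
  moving two copies one step apart raises the deficit at that point only. Iterating leads to the
  transitive tournament, and every move is undone by a transfer.\<close>

lemma ex_tournament_of_landau_mset:
  assumes "landau_mset n M"
  shows "\<exists>E. tournament {0..<n} E \<and> image_mset (out_deg E) (mset_set {0..<n}) = M"
  using assms
\<comment> \<open>The measure is the total slack in Landau's inequalities.\<close>
proof (induction "\<Sum>v\<le>n. (Suc v choose 2) - deficit M v" arbitrary: M rule: less_induct)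
  case less
  have M: "size M = n" "\<And>v. v \<le> n \<Longrightarrow> deficit M v \<le> Suc v choose 2" "deficit M n = Suc n choose 2"
    using less.prems by (auto simp: landau_mset_def)
  define A where "A v = (Suc v choose 2) - deficit M v" for v
  show ?case
  proof (cases "\<forall>v\<le>n. A v = 0")
    case True
    then have "M = mset_set {0..<n}"
      using M by (intro tight_landau_mset) (auto simp: A_def intro: antisym)
    then show ?thesis using ex_tournament_transitive by auto
  next
    case False
    define m where "m = Max (A ` {..n})"
    have Am: "A j \<le> m" if "j \<le> n" for j
      using that unfolding m_def by auto
    have "m \<in> A ` {..n}" unfolding m_def by (rule Max_in) auto
    then have ex: "\<exists>v. v \<le> n \<and> A v = m" by auto
    define a where "a = (LEAST v. v \<le> n \<and> A v = m)"
    have a: "a \<le> n" "A a = m" using LeastI_ex[OF ex] by (auto simp: a_def)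
    have m0: "m > 0" using False Am by fastforce
    \<comment> \<open>There is no slack at either end, so the first maximum of the slack is interior
      and has two neighbours.\<close>
    have "A 0 = 0" "A n = 0" using M by (auto simp: A_def)
    with a m0 have "a \<noteq> 0" "a \<noteq> n" by (metis less_irrefl)+
    then obtain b where b: "a = Suc b" "Suc (Suc b) \<le> n" using a by (cases a) auto
    have "A b \<noteq> m" using not_less_Least[of b "\<lambda>v. v \<le> n \<and> A v = m"] a b by (auto simp: a_def)
    then have Ab: "A b < A (Suc b)" "A (Suc (Suc b)) \<le> A (Suc b)"
      using Am[of b] Am[of "Suc (Suc b)"] a b by auto
    \<comment> \<open>At the first maximum the second difference of the slack is at most -1, that of
      \<open>Suc v choose 2\<close> is 1, so that of the deficit, which is the multiplicity, is at
      least 2.\<close>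
    have "count M (Suc b) \<ge> 2"
      using Ab deficit_second_difference[of M b] M(2)[of b] M(2)[of "Suc b"] M(2)[of "Suc (Suc b)"] b
      unfolding A_def by (simp add: numeral_2_eq_2)
    then have "replicate_mset 2 (Suc b) \<subseteq># M"
      by (simp add: count_le_replicate_mset_subset_eq)
    then obtain N where N: "M = add_mset (Suc b) (add_mset (Suc b) N)"
      by (auto simp: numeral_2_eq_2 dest!: mset_subset_eq_exists_conv[THEN iffD1])
    define M' where "M' = add_mset (Suc (Suc b)) (add_mset b N)"
    have d: "deficit M' v = deficit M v + (if v = Suc b then 1 else 0)" for v
      unfolding M'_def N by auto
    have pos: "deficit M (Suc b) < Suc (Suc b) choose 2"
      using a b m0 by (simp add: A_def)
    have L: "landau_mset n M'"
      unfolding landau_mset_def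
    proof (intro conjI allI impI)
      show "size M' = n" using M N by (simp add: M'_def)
      show "deficit M' n = Suc n choose 2" using M d \<open>a \<noteq> n\<close> b by auto
      show "deficit M' v \<le> Suc v choose 2" if "v \<le> n" for v
        using M(2)[OF that] d pos by auto
    qed
    have "(\<Sum>v\<le>n. (Suc v choose 2) - deficit M' v) < (\<Sum>v\<le>n. (Suc v choose 2) - deficit M v)"
    proof (rule sum_strict_mono_ex1)
      show "\<exists>v\<in>{..n}. (Suc v choose 2) - deficit M' v < (Suc v choose 2) - deficit M v"
        using pos d b by (intro bexI[of _ "Suc b"]) auto
    qed (use d in auto)
    from less.hyps[OF this L] obtain E where "tournament {0..<n} E"
      "image_mset (out_deg E) (mset_set {0..<n}) = M'" by blast
    then show ?thesis
      using realizable_transfer[of "{0..<n}" E b N] unfolding M'_def N by blast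
  qed
qed

subsection \<open>Multiplicity lists\<close>

definition counts :: "nat \<Rightarrow> nat multiset \<Rightarrow> nat list" where
  "counts n M = map (count M) [0..<n]"

lemma length_counts [simp]: "length (counts n M) = n"
  by (simp add: counts_def)

lemma counts_Suc: "counts (Suc n) M = counts n M @ [count M n]"
  by (simp add: counts_def)

lemma take_counts: "j \<le> n \<Longrightarrow> take j (counts n M) = counts j M"
  by (simp add: counts_def take_map)

lemma nth_counts: "i < n \<Longrightarrow> counts n M ! i = count M i"
  by (simp add: counts_def)

lemma sum_list_counts: "sum_list (counts v M) = size {#x \<in># M. x < v#}"
proof (induction v)
  case (Suc v)
  have "size {#x \<in># M. x < Suc v#} = size {#x \<in># M. x < v#} + count M v"
    by (induction M) (auto simp: less_Suc_eq)
  with Suc show ?case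
    by (simp add: counts_Suc)
qed (simp add: counts_def)

lemma deficit_Suc: "deficit M (Suc v) = deficit M v + size {#x \<in># M. x < Suc v#}"
  by (induction M) auto

text \<open>Both sides have the same increments, the number of elements below \<open>Suc v\<close>
  minus \<open>Suc v\<close>. This turns Landau's inequalities into nonpositivity of the partial
  areas.\<close>

lemma area_counts: "area (counts v M) = int (deficit M v) - int (Suc v choose 2)"
proof (induction v)
  case 0
  show ?case by (simp add: counts_def numeral_2_eq_2)
next
  case (Suc v)
  have "area (counts (Suc v) M) = area (counts v M) + height (counts (Suc v) M)"
    by (simp add: counts_Suc area_append height_def)
  also have "height (counts (Suc v) M) = int (size {#x \<in># M. x < Suc v#}) - int (Suc v)"
    by (simp add: height_def sum_list_counts)
  finally show ?case
    using Suc by (simp add: deficit_Suc numeral_2_eq_2)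
qed

lemma height_counts:
  assumes "set_mset M \<subseteq> {0..<n}"
  shows "height (counts n M) = int (size M) - int n"
proof -
  have "{#x \<in># M. x < n#} = M"
    using assms by (auto simp: filter_mset_eq_conv)
  then show ?thesis
    by (simp add: height_def sum_list_counts)
qed

lemma bij_betw_counts: "bij_betw (counts n) {M. set_mset M \<subseteq> {0..<n}} {xs. length xs = n}"
proof (rule bij_betwI')
  fix M N assume "M \<in> {M. set_mset M \<subseteq> {0..<n}}" "N \<in> {M. set_mset M \<subseteq> {0..<n}}"
  then have "count M i = count N i" if "counts n M = counts n N" for i
  proof (cases "i < n")
    case True
    then show ?thesis
      using that nth_counts[of i n M] nth_counts[of i n N] by simp
  next
    case False
    with \<open>M \<in> _\<close> \<open>N \<in> _\<close> have "i \<notin># M" "i \<notin># N"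
      by auto
    then show ?thesis
      by (simp add: not_in_iff)
  qed
  then show "counts n M = counts n N \<longleftrightarrow> M = N"
    by (auto intro: multiset_eqI)
next
  fix xs :: "nat list" assume "xs \<in> {xs. length xs = n}"
  then have len: "length xs = n" by simp
  define M where "M = (\<Sum>i<n. replicate_mset (xs ! i) i)"
  have c: "count M j = (if j < n then xs ! j else 0)" for j
    by (simp add: M_def count_sum)
  then have "set_mset M \<subseteq> {0..<n}"
    by (metis atLeastLessThan_iff count_eq_zero_iff subsetI zero_le)
  moreover have "xs = counts n M"
    by (rule nth_equalityI) (auto simp: len nth_counts c)
  ultimately show "\<exists>M\<in>{M. set_mset M \<subseteq> {0..<n}}. xs = counts n M"
    by blast
qed simp

lemma landau_list_counts_iff:
  assumes "set_mset M \<subseteq> {0..<n}"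
  shows "landau_list (counts n M) \<longleftrightarrow> landau_mset n M"
  using height_counts[OF assms]
  by (auto simp: landau_list_def landau_mset_def take_counts area_counts)

section \<open>Score sequences and EGZ multisets as walks\<close>

lemma bij_betw_restrict:
  assumes "bij_betw f A B" "\<And>x. x \<in> A \<Longrightarrow> Q (f x) \<longleftrightarrow> P x"
  shows "bij_betw f {x \<in> A. P x} {y \<in> B. Q y}"
  using assms unfolding bij_betw_def inj_on_def by auto

text \<open>Landau's theorem as a bijection: a score sequence is sorted, hence determined by its
  multiset.\<close>

lemma bij_betw_mset_score_sequences:
  "bij_betw mset (score_sequences n) {M. set_mset M \<subseteq> {0..<n} \<and> landau_mset n M}"
  unfolding bij_betw_def
proof
  have sorted: "sorted s" if "s \<in> score_sequences n" for s
    using that by (auto simp: score_sequences_def score_sequence_def)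
  then show "inj_on mset (score_sequences n)"
    by (intro inj_onI) (metis properties_for_sort sorted)
  have image: "mset ` score_sequences n =
      {image_mset (out_deg E) (mset_set {0..<n}) | E. tournament {0..<n} E}"
    by (force simp: score_sequences_def score_sequence_def)
  show "mset ` score_sequences n = {M. set_mset M \<subseteq> {0..<n} \<and> landau_mset n M}"
    unfolding image
  proof (intro equalityI subsetI)
    fix M assume "M \<in> {image_mset (out_deg E) (mset_set {0..<n}) | E. tournament {0..<n} E}"
    then obtain E where E: "tournament {0..<n} E" "M = image_mset (out_deg E) (mset_set {0..<n})"
      by blast
    then show "M \<in> {M. set_mset M \<subseteq> {0..<n} \<and> landau_mset n M}"
      using landau_mset_out_deg[OF E(1)] tournament_out_deg_less[OF E(1)] by auto
  next
    fix M assume "M \<in> {M. set_mset M \<subseteq> {0..<n} \<and> landau_mset n M}"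
    then show "M \<in> {image_mset (out_deg E) (mset_set {0..<n}) | E. tournament {0..<n} E}"
      using ex_tournament_of_landau_mset[of n M] by blast
  qed
qed

lemma bij_betw_score_sequences_landau_lists:
  "bij_betw (\<lambda>s. counts n (mset s)) (score_sequences n) (landau_lists n)"
proof -
  have "bij_betw (counts n) {M. set_mset M \<subseteq> {0..<n} \<and> landau_mset n M} (landau_lists n)"
    using bij_betw_restrict[OF bij_betw_counts, of n landau_list "landau_mset n"]
      landau_list_counts_iff by (simp add: landau_lists_def)
  from bij_betw_trans[OF bij_betw_mset_score_sequences this] show ?thesis
    by (simp add: comp_def)
qed

lemma deficit_add_sum_mset:
  "set_mset M \<subseteq> {0..<n} \<Longrightarrow> deficit M n + \<Sum>\<^sub># M = n * size M"
  by (induction M) auto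

text \<open>The deficit at \<open>n\<close> is \<open>n * n\<close> minus the sum, and
  \<open>n * n = (n choose 2) + (Suc n choose 2)\<close>. Hence \<open>n\<close> divides the area
  exactly when the sum is congruent to \<open>n choose 2\<close>.\<close>

lemma area_counts_total:
  assumes "set_mset M \<subseteq> {0..<n}" "size M = n"
  shows "area (counts n M) = int (n choose 2) - int (\<Sum>\<^sub># M)"
proof -
  have "2 * ((n choose 2) + (Suc n choose 2)) = 2 * (n * n)"
    unfolding distrib_left double_choose_two by (cases n) (auto simp: algebra_simps)
  then have "(n choose 2) + (Suc n choose 2) = n * n"
    by (simp only: mult_cancel1) simp
  then have "deficit M n + \<Sum>\<^sub># M = (n choose 2) + (Suc n choose 2)"
    using deficit_add_sum_mset[OF assms(1)] unfolding assms(2) by (simp only:)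
  then show ?thesis
    unfolding area_counts by linarith
qed

lemma bij_betw_EGZ_EGZ_lists: "bij_betw (counts n) (EGZ n) (EGZ_lists n)"
proof -
  have iff: "height (counts n M) = 0 \<and> int n dvd area (counts n M) \<longleftrightarrow>
      size M = n \<and> [\<Sum>\<^sub># M = n choose 2] (mod n)" if "set_mset M \<subseteq> {0..<n}" for M
  proof (cases "size M = n")
    case True
    have "[\<Sum>\<^sub># M = n choose 2] (mod n) \<longleftrightarrow> int n dvd int (n choose 2) - int (\<Sum>\<^sub># M)"
      by (metis cong_iff_dvd_diff cong_int_iff cong_sym_eq)
    then show ?thesis
      using True that by (simp add: height_counts area_counts_total)
  next
    case False
    then show ?thesis
      using that by (simp add: height_counts)
  qed
  have "EGZ n = {M \<in> {M. set_mset M \<subseteq> {0..<n}}. size M = n \<and> [\<Sum>\<^sub># M = n choose 2] (mod n)}"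
    by (auto simp: EGZ_def)
  moreover have "EGZ_lists n = {xs \<in> {xs. length xs = n}. height xs = 0 \<and> int n dvd area xs}"
    by (auto simp: EGZ_lists_def)
  ultimately show ?thesis
    using bij_betw_restrict[OF bij_betw_counts, of n "\<lambda>xs. height xs = 0 \<and> int n dvd area xs"
        "\<lambda>M. size M = n \<and> [\<Sum>\<^sub># M = n choose 2] (mod n)"] iff by simp
qed

section \<open>Coefficients of the generating series\<close>

lemma card_indices_eq_count: "card {j. j < length s \<and> s ! j = i} = count (mset s) i"
  by (simp add: count_mset count_list_eq_length_filter length_filter_conv_card eq_commute)

lemma S_gf_nth: "fps_nth S_gf n = of_nat (card (landau_lists n))"
  using bij_betw_same_card[OF bij_betw_score_sequences_landau_lists, of n] by (simp add: S_gf_def)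

lemma finite_landau_lists: "finite (landau_lists n)"
  using bij_betw_finite[OF bij_betw_score_sequences_landau_lists] finite_score_sequences by blast

lemma finite_first_block_pointed: "finite (first_block_pointed n)"
  by (rule finite_subset[of _ "landau_lists n \<times> {..<n}"])
     (auto simp: first_block_pointed_def finite_landau_lists)

lemma S_pt_gf_nth:
  "fps_nth S_pt_gf n = (\<Sum>(xs, i)\<in>landau_lists n \<times> {0..<n}. monom 1 (xs ! i))"
proof -
  have "fps_nth S_pt_gf n = (\<Sum>(s, i)\<in>score_sequences n \<times> {0..<n}. monom 1 (count (mset s) i))"
    by (auto simp: S_pt_gf_def pointed_score_sequences_def card_indices_eq_count)
  also have "\<dots> = (\<Sum>s\<in>score_sequences n. \<Sum>i\<in>{0..<n}. monom 1 (counts n (mset s) ! i))"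
    by (simp add: sum.cartesian_product[symmetric] nth_counts)
  also have "\<dots> = (\<Sum>xs\<in>landau_lists n. \<Sum>i\<in>{0..<n}. monom 1 (xs ! i))"
    by (rule sum.reindex_bij_betw[OF bij_betw_score_sequences_landau_lists])
  finally show ?thesis
    by (simp add: sum.cartesian_product)
qed

text \<open>The multiplicity of 0 is the first entry of the list of counts, which is the marked
  entry before rotation. For \<open>n = 0\<close> both sides vanish.\<close>

lemma EGZ_gf_nth: "fps_nth EGZ_gf n = (\<Sum>(xs, i)\<in>first_block_pointed n. monom 1 (xs ! i))"
proof (cases "n = 0")
  case True
  then show ?thesis by (simp add: EGZ_gf_def first_block_pointed_def)
next
  case False
  have "fps_nth EGZ_gf n = (\<Sum>M\<in>EGZ n. monom 1 (counts n M ! 0))"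
    using False by (simp add: EGZ_gf_def nth_counts)
  also have "\<dots> = (\<Sum>xs\<in>EGZ_lists n. monom 1 (xs ! 0))"
    by (rule sum.reindex_bij_betw[OF bij_betw_EGZ_EGZ_lists])
  also have "\<dots> = (\<Sum>p\<in>first_block_pointed n. monom 1 ((case p of (xs, i) \<Rightarrow> rotate i xs) ! 0))"
    using False inj_on_rotate_first_block_pointed[of n] rotate_first_block_pointed[of n]
    by (intro sum.reindex_bij_betw[symmetric]) (auto simp: bij_betw_def)
  also have "\<dots> = (\<Sum>(xs, i)\<in>first_block_pointed n. monom 1 (xs ! i))"
  proof -
    have "rotate i xs ! 0 = xs ! i" if "i < length xs" for i and xs :: "nat list"
      using that by (subst nth_rotate) auto
    then show ?thesis
      by (intro sum.cong) (auto simp: first_block_pointed_def landau_lists_def)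
  qed
  finally show ?thesis .
qed

theorem theorem4: "S_pt_gf = EGZ_gf * S_gf"
proof (rule fps_ext)
  fix n
  let ?A = "SIGMA k:{0..n}. first_block_pointed k \<times> landau_lists (n - k)"
  have "fps_nth S_pt_gf n = (\<Sum>(xs, i)\<in>landau_lists n \<times> {0..<n}. monom 1 (xs ! i))"
    by (rule S_pt_gf_nth)
  also have "\<dots> = (\<Sum>q\<in>?A. (\<lambda>(zs, i). monom 1 (zs ! i))
      ((\<lambda>(k, (ys, i), xs). (xs @ ys, length xs + i)) q))"
    by (rule sum.reindex_bij_betw[OF bij_betw_append_first_block_pointed, symmetric])
  \<comment> \<open>The mark lies in \<open>ys\<close>, so the prefix \<open>xs\<close> does not
    affect the weight; summing over it only counts the Landau lists of length
    \<open>n - k\<close>.\<close>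
  also have "\<dots> = (\<Sum>(k, (ys, i), xs)\<in>?A. monom 1 (ys ! i))"
    by (intro sum.cong) auto
  also have "\<dots> = (\<Sum>k=0..n. \<Sum>((ys, i), xs)\<in>first_block_pointed k \<times> landau_lists (n - k). monom 1 (ys ! i))"
    by (subst sum.Sigma) (auto simp: finite_first_block_pointed finite_landau_lists)
  also have "\<dots> = (\<Sum>k=0..n. fps_nth EGZ_gf k * fps_nth S_gf (n - k))"
  proof (rule sum.cong[OF refl])
    fix k
    have "(\<Sum>((ys, i), xs)\<in>first_block_pointed k \<times> landau_lists (n - k). monom 1 (ys ! i)) =
        (\<Sum>p\<in>first_block_pointed k. \<Sum>xs\<in>landau_lists (n - k). case p of (ys, i) \<Rightarrow> monom (1::int) (ys ! i))"
      unfolding sum.cartesian_product by (intro sum.cong) auto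
    then show "(\<Sum>((ys, i), xs)\<in>first_block_pointed k \<times> landau_lists (n - k). monom 1 (ys ! i)) =
        fps_nth EGZ_gf k * fps_nth S_gf (n - k)"
      by (simp add: EGZ_gf_nth S_gf_nth sum_distrib_left mult.commute)
  qed
  also have "\<dots> = fps_nth (EGZ_gf * S_gf) n"
    by (simp add: fps_mult_nth)
  finally show "fps_nth S_pt_gf n = fps_nth (EGZ_gf * S_gf) n" .
qed

end
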